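(* Let $G$ be a graph. For every perfect matching $M$ of $G$, $f_G(M)\ge f(G,M)$. Furthermore, if $G$ is bipartite, then $f_G(M)=f(G,M)$.
   Context: Graphs are finite, simple and undirected. A perfect matching of $G$ is a set $M\subseteq E(G)$ such that every vertex lies in exactly one edge of $M$; it is identified with its characteristic function $\mathbb{1}_M:E(G)\to\{0,1\}$, so $f_G(M)$ means $f_G(\mathbb{1}_M)$. A subset $S\subseteq M$ is a forcing set for $M$ if $M$ is the unique perfect matching of $G$ containing $S$, and $f(G,M)=\min\{|S|:S\text{ is a forcing set for }M\}$. A fractional matching of $G$ is a function $\alpha:E(G)\to\mathbb{R}^{\ge 0}$ with $\sum_{e\ni v}\alpha(e)\le 1$ for every $v\in V(G)$; it is a fractional perfect matching if equality holds at every $v$. Write $\|\alpha\|_1=\sum_{e\in E(G)}|\alpha(e)|$, and $\alpha\preceq\gamma$ if $\alpha(e)\le\gamma(e)$ for all $e$. For a fractional matching $\alpha$ and a fractional perfect matching $\gamma$, write $\alpha\uparrow\gamma$ if $\alpha\preceq\gamma$ and $\gamma$ is the only fractional perfect matching $\gamma'$ with $\alpha\preceq\gamma'$. The fractional forcing number of $\gamma$ is $f_G(\gamma)=\inf\{\|\alpha\|_1:\alpha\uparrow\gamma\}$. *)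

theory Defs
  imports Complex_Main "HOL-Library.Indicator_Function"
begin

definition simple_graph :: "'a set \<Rightarrow> 'a set set \<Rightarrow> bool" where
  "simple_graph V E \<longleftrightarrow> finite V \<and> (\<forall>e\<in>E. e \<subseteq> V \<and> card e = 2)"

definition bipartite :: "'a set \<Rightarrow> 'a set set \<Rightarrow> bool" where
  "bipartite V E \<longleftrightarrow>
     (\<exists>X Y. X \<union> Y = V \<and> X \<inter> Y = {} \<and> (\<forall>e\<in>E. \<exists>x\<in>X. \<exists>y\<in>Y. e = {x, y}))"

definition perfect_matching :: "'a set \<Rightarrow> 'a set set \<Rightarrow> 'a set set \<Rightarrow> bool" where
  "perfect_matching V E M \<longleftrightarrow> M \<subseteq> E \<and> (\<forall>v\<in>V. \<exists>!e. e \<in> M \<and> v \<in> e)"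

definition forcing_set :: "'a set \<Rightarrow> 'a set set \<Rightarrow> 'a set set \<Rightarrow> 'a set set \<Rightarrow> bool" where
  "forcing_set V E M S \<longleftrightarrow> S \<subseteq> M \<and> {M'. perfect_matching V E M' \<and> S \<subseteq> M'} = {M}"

definition forcing_number :: "'a set \<Rightarrow> 'a set set \<Rightarrow> 'a set set \<Rightarrow> nat" where
  "forcing_number V E M = Min {card S | S. forcing_set V E M S}"

text \<open>A function on the edge set is represented by a total function on sets of vertices.
  Only its values on \<open>E\<close> matter; accordingly, two such functions count as the same
  function on \<open>E\<close> when they agree on \<open>E\<close>.\<close>

definition fractional_matching :: "'a set \<Rightarrow> 'a set set \<Rightarrow> ('a set \<Rightarrow> real) \<Rightarrow> bool" where
  "fractional_matching V E \<alpha> \<longleftrightarrow>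
     (\<forall>e\<in>E. 0 \<le> \<alpha> e) \<and> (\<forall>v\<in>V. (\<Sum>e\<in>{e\<in>E. v \<in> e}. \<alpha> e) \<le> 1)"

definition fractional_perfect_matching :: "'a set \<Rightarrow> 'a set set \<Rightarrow> ('a set \<Rightarrow> real) \<Rightarrow> bool" where
  "fractional_perfect_matching V E \<gamma> \<longleftrightarrow>
     fractional_matching V E \<gamma> \<and> (\<forall>v\<in>V. (\<Sum>e\<in>{e\<in>E. v \<in> e}. \<gamma> e) = 1)"

definition l1_norm :: "'a set set \<Rightarrow> ('a set \<Rightarrow> real) \<Rightarrow> real" where
  "l1_norm E \<alpha> = (\<Sum>e\<in>E. \<bar>\<alpha> e\<bar>)"

definition dominated :: "'a set set \<Rightarrow> ('a set \<Rightarrow> real) \<Rightarrow> ('a set \<Rightarrow> real) \<Rightarrow> bool" where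
  "dominated E \<alpha> \<gamma> \<longleftrightarrow> (\<forall>e\<in>E. \<alpha> e \<le> \<gamma> e)"

definition fractionally_forces ::
  "'a set \<Rightarrow> 'a set set \<Rightarrow> ('a set \<Rightarrow> real) \<Rightarrow> ('a set \<Rightarrow> real) \<Rightarrow> bool" where
  "fractionally_forces V E \<alpha> \<gamma> \<longleftrightarrow>
     fractional_matching V E \<alpha> \<and> fractional_perfect_matching V E \<gamma> \<and> dominated E \<alpha> \<gamma> \<and>
     (\<forall>\<gamma>'. fractional_perfect_matching V E \<gamma>' \<and> dominated E \<alpha> \<gamma>' \<longrightarrow> (\<forall>e\<in>E. \<gamma>' e = \<gamma> e))"

definition fractional_forcing_number :: "'a set \<Rightarrow> 'a set set \<Rightarrow> ('a set \<Rightarrow> real) \<Rightarrow> real" where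
  "fractional_forcing_number V E \<gamma> = Inf {l1_norm E \<alpha> | \<alpha>. fractionally_forces V E \<alpha> \<gamma>}"

end

theory Submission
  imports Defs
begin

text \<open>Both halves compare a perfect matching \<open>M\<close> with the fractional perfect matchings that
  dominate the indicator of some \<open>S \<subseteq> M\<close>.

  For the inequality, let \<open>\<alpha>\<close> force \<open>M\<close> fractionally and let \<open>T\<close> be the set of edges of \<open>M\<close> on
  which \<open>\<alpha>\<close> is \<open>1\<close>. A fractional perfect matching \<open>\<gamma>\<close> that is \<open>1\<close> on \<open>T\<close> need not dominate
  \<open>\<alpha>\<close>, but \<open>(1 - t) M + t \<gamma>\<close> does for small \<open>t > 0\<close>, because on \<open>M - T\<close> the value of \<open>\<alpha>\<close> is
  bounded away from \<open>1\<close>. Hence \<open>\<gamma> = M\<close>, and the entries of \<open>\<alpha>\<close> strictly between \<open>0\<close> and \<open>1\<close>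
  contribute nothing to forcing (\<open>fractionally_forces_saturated\<close>). So \<open>T\<close> is an ordinary forcing
  set, and it has at most \<open>\<parallel>\<alpha>\<parallel>\<^sub>1\<close> elements.

  For equality in bipartite graphs it suffices that every forcing set \<open>S\<close> of \<open>M\<close> also forces
  fractionally (\<open>bipartite_forcing_imp_fractionally_forces\<close>). If a fractional perfect matching
  \<open>\<gamma> \<noteq> M\<close> is \<open>1\<close> on \<open>S\<close>, then one can walk forever along edges of \<open>M\<close> where \<open>\<gamma>\<close> is below \<open>1\<close>
  and edges outside \<open>M\<close> where \<open>\<gamma>\<close> is positive, alternately. By finiteness the walk closes up.
  Bipartiteness makes the closed walk an honest \<open>M\<close>-alternating cycle, and switching \<open>M\<close> along
  it gives another perfect matching that still contains \<open>S\<close>.\<close>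

section \<open>Fractional perfect matchings\<close>

lemma simple_graph_finite_edges:
  assumes "simple_graph V E"
  shows "finite E"
proof (rule finite_subset)
  show "E \<subseteq> Pow V" using assms by (auto simp: simple_graph_def)
  show "finite (Pow V)" using assms by (simp add: simple_graph_def)
qed

lemma simple_graph_edge_vertex:
  assumes "simple_graph V E" "e \<in> E"
  obtains v where "v \<in> e" "v \<in> V"
proof -
  have "e \<subseteq> V" "card e = 2" using assms by (auto simp: simple_graph_def)
  moreover from this have "e \<noteq> {}" by auto
  ultimately show ?thesis using that by auto
qed

lemma perfect_matching_unique:
  assumes "perfect_matching V E M" "v \<in> V" "e \<in> M" "v \<in> e" "e' \<in> M" "v \<in> e'"
  shows "e = e'"
  using assms unfolding perfect_matching_def by blast

lemma perfect_matching_edge: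
  assumes "perfect_matching V E M" "v \<in> V"
  obtains e where "e \<in> M" "e \<in> E" "v \<in> e"
  using assms unfolding perfect_matching_def by blast

lemma fractional_perfect_matching_indicator:
  assumes G: "simple_graph V E" and M: "perfect_matching V E M"
  shows "fractional_perfect_matching V E (indicator M)"
proof -
  have "(\<Sum>e\<in>{e\<in>E. v \<in> e}. indicator M e) = (1::real)" if v: "v \<in> V" for v
  proof -
    obtain e where e: "e \<in> M" "e \<in> E" "v \<in> e" using perfect_matching_edge[OF M v] .
    have "(\<Sum>e\<in>{e\<in>E. v \<in> e}. indicator M e) = (\<Sum>e\<in>{e}. indicator M e :: real)"
    proof (rule sum.mono_neutral_right)
      show "\<forall>i\<in>{e \<in> E. v \<in> e} - {e}. indicator M i = (0::real)"
        using perfect_matching_unique[OF M v] e by (auto simp: indicator_def)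
    qed (use e simple_graph_finite_edges[OF G] in auto)
    then show ?thesis using e by simp
  qed
  then show ?thesis
    by (simp add: fractional_perfect_matching_def fractional_matching_def)
qed

lemma fractional_perfect_matching_remove:
  assumes G: "simple_graph V E" and \<gamma>: "fractional_perfect_matching V E \<gamma>"
    and v: "v \<in> V" "v \<in> e" and e: "e \<in> E"
  shows "(\<Sum>e'\<in>{e'\<in>E. v \<in> e'} - {e}. \<gamma> e') = 1 - \<gamma> e"
proof -
  have "(\<Sum>e'\<in>{e'\<in>E. v \<in> e'}. \<gamma> e') = \<gamma> e + (\<Sum>e'\<in>{e'\<in>E. v \<in> e'} - {e}. \<gamma> e')"
    by (rule sum.remove) (use simple_graph_finite_edges[OF G] v e in auto)
  moreover have "(\<Sum>e'\<in>{e'\<in>E. v \<in> e'}. \<gamma> e') = 1"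
    using \<gamma> v by (simp add: fractional_perfect_matching_def)
  ultimately show ?thesis by simp
qed

lemma fractional_perfect_matching_nonneg:
  assumes "fractional_perfect_matching V E \<gamma>" "e \<in> E"
  shows "0 \<le> \<gamma> e"
  using assms by (simp add: fractional_perfect_matching_def fractional_matching_def)

lemma fractional_perfect_matching_two_le_one:
  assumes G: "simple_graph V E" and \<gamma>: "fractional_perfect_matching V E \<gamma>"
    and v: "v \<in> V" "v \<in> e" "v \<in> e'" and e: "e \<in> E" "e' \<in> E" "e \<noteq> e'"
  shows "\<gamma> e + \<gamma> e' \<le> 1"
proof -
  have "\<gamma> e' \<le> (\<Sum>e'\<in>{e'\<in>E. v \<in> e'} - {e}. \<gamma> e')"
    by (rule member_le_sum)
      (use simple_graph_finite_edges[OF G] v e fractional_perfect_matching_nonneg[OF \<gamma>] in auto)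
  then show ?thesis using fractional_perfect_matching_remove[OF G \<gamma> v(1,2) e(1)] by simp
qed

lemma fractional_perfect_matching_le_one:
  assumes G: "simple_graph V E" and \<gamma>: "fractional_perfect_matching V E \<gamma>" and e: "e \<in> E"
  shows "\<gamma> e \<le> 1"
proof -
  obtain v where v: "v \<in> e" "v \<in> V" using simple_graph_edge_vertex[OF G e] .
  have "0 \<le> (\<Sum>e'\<in>{e'\<in>E. v \<in> e'} - {e}. \<gamma> e')"
    by (rule sum_nonneg) (use fractional_perfect_matching_nonneg[OF \<gamma>] in auto)
  then show ?thesis using fractional_perfect_matching_remove[OF G \<gamma> v(2,1) e] by simp
qed

lemma fractional_perfect_matching_other_edge:
  assumes G: "simple_graph V E" and \<gamma>: "fractional_perfect_matching V E \<gamma>"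
    and v: "v \<in> V" "v \<in> e" and e: "e \<in> E" "\<gamma> e < 1"
  obtains e' where "e' \<in> E" "v \<in> e'" "e' \<noteq> e" "0 < \<gamma> e'"
proof -
  have "0 < (\<Sum>e'\<in>{e'\<in>E. v \<in> e'} - {e}. \<gamma> e')"
    using fractional_perfect_matching_remove[OF G \<gamma> v e(1)] e(2) by simp
  then have "\<exists>e'\<in>{e'\<in>E. v \<in> e'} - {e}. 0 < \<gamma> e'"
    by (meson not_less sum_nonpos)
  then show ?thesis using that by auto
qed

text \<open>A fractional perfect matching different from \<open>M\<close> falls below \<open>1\<close> somewhere on \<open>M\<close>: if it is
  \<open>1\<close> on all of \<open>M\<close>, every vertex is already saturated.\<close>

lemma fractional_perfect_matching_eq_indicator:
  assumes G: "simple_graph V E" and M: "perfect_matching V E M"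
    and \<gamma>: "fractional_perfect_matching V E \<gamma>" and one: "\<And>e. e \<in> M \<Longrightarrow> 1 \<le> \<gamma> e"
    and e: "e \<in> E"
  shows "\<gamma> e = indicator M e"
proof (cases "e \<in> M")
  case True
  then show ?thesis using one[OF True] fractional_perfect_matching_le_one[OF G \<gamma> e] by simp
next
  case False
  obtain v where v: "v \<in> e" "v \<in> V" using simple_graph_edge_vertex[OF G e] .
  obtain m where m: "m \<in> M" "m \<in> E" "v \<in> m" using perfect_matching_edge[OF M v(2)] .
  have "\<gamma> m + \<gamma> e \<le> 1"
    using fractional_perfect_matching_two_le_one[OF G \<gamma> v(2) m(3) v(1) m(2) e] m False by auto
  then show ?thesis
    using one[OF m(1)] fractional_perfect_matching_nonneg[OF \<gamma> e] False by simp
qed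

lemma fractional_perfect_matching_convex:
  assumes "fractional_perfect_matching V E \<beta>" "fractional_perfect_matching V E \<gamma>"
    and "0 \<le> t" "t \<le> 1"
  shows "fractional_perfect_matching V E (\<lambda>e. (1 - t) * \<beta> e + t * \<gamma> e)"
  using assms
  by (simp add: fractional_perfect_matching_def fractional_matching_def sum.distrib
      flip: sum_distrib_left)

section \<open>Forcing sets and indicator functions\<close>

lemma fractionally_forces_indicator_iff:
  assumes G: "simple_graph V E" and M: "perfect_matching V E M" and S: "S \<subseteq> M"
  shows "fractionally_forces V E (indicator S) (indicator M) \<longleftrightarrow>
    (\<forall>\<gamma>. fractional_perfect_matching V E \<gamma> \<and> (\<forall>e\<in>S. 1 \<le> \<gamma> e) \<longrightarrow>
      (\<forall>e\<in>E. \<gamma> e = indicator M e))"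
proof -
  have le: "indicator S e \<le> (indicator M e :: real)" for e
    using S by (auto simp: indicator_def)
  have fpm: "fractional_perfect_matching V E (indicator M)"
    by (rule fractional_perfect_matching_indicator[OF G M])
  have "(\<Sum>e\<in>{e\<in>E. v \<in> e}. indicator S e) \<le> (1::real)" if "v \<in> V" for v
  proof -
    have "(\<Sum>e\<in>{e\<in>E. v \<in> e}. indicator S e) \<le> (\<Sum>e\<in>{e\<in>E. v \<in> e}. indicator M e :: real)"
      by (rule sum_mono) (rule le)
    then show ?thesis using fpm that by (simp add: fractional_perfect_matching_def)
  qed
  then have "fractional_matching V E (indicator S)" by (simp add: fractional_matching_def)
  moreover have "dominated E (indicator S) \<gamma> \<longleftrightarrow> (\<forall>e\<in>S. 1 \<le> \<gamma> e)"
    if "fractional_perfect_matching V E \<gamma>" for \<gamma>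
  proof -
    have "S \<subseteq> E" using S M by (auto simp: perfect_matching_def)
    then show ?thesis
      using fractional_perfect_matching_nonneg[OF that]
      unfolding dominated_def by (auto simp: indicator_def)
  qed
  moreover have "dominated E (indicator S) (indicator M)" using le by (simp add: dominated_def)
  ultimately show ?thesis using fpm unfolding fractionally_forces_def by blast
qed

lemma fractionally_forces_indicator_self:
  assumes "simple_graph V E" "perfect_matching V E M"
  shows "fractionally_forces V E (indicator M) (indicator M)"
  using fractional_perfect_matching_eq_indicator[OF assms]
    fractionally_forces_indicator_iff[OF assms subset_refl] by blast

lemma fractionally_forces_imp_forcing:
  assumes G: "simple_graph V E" and M: "perfect_matching V E M" and S: "S \<subseteq> M"
    and forces: "fractionally_forces V E (indicator S) (indicator M)"
  shows "forcing_set V E M S"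
proof -
  have "M' = M" if M': "perfect_matching V E M'" "S \<subseteq> M'" for M'
  proof -
    have "fractional_perfect_matching V E (indicator M')" "\<forall>e\<in>S. (1::real) \<le> indicator M' e"
      using fractional_perfect_matching_indicator[OF G M'(1)] M'(2) by (auto simp: indicator_def)
    then have "\<forall>e\<in>E. indicator M' e = (indicator M e :: real)"
      using forces[unfolded fractionally_forces_indicator_iff[OF G M S]] by blast
    then have "e \<in> M' \<longleftrightarrow> e \<in> M" if "e \<in> E" for e
      using that by (metis indicator_eq_1_iff)
    moreover have "M \<subseteq> E" "M' \<subseteq> E" using M M'(1) by (auto simp: perfect_matching_def)
    ultimately show ?thesis by blast
  qed
  then have "{M'. perfect_matching V E M' \<and> S \<subseteq> M'} = {M}" using M S by blast
  then show ?thesis using S unfolding forcing_set_def by blast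
qed

text \<open>Only the edges on which \<open>\<alpha>\<close> equals \<open>1\<close> matter for forcing: by convexity, a competitor of
  \<open>M\<close> for these edges alone can be moved so close to \<open>M\<close> that it dominates \<open>\<alpha>\<close>.\<close>

lemma fractionally_forces_saturated:
  assumes G: "simple_graph V E" and M: "perfect_matching V E M"
    and forces: "fractionally_forces V E \<alpha> (indicator M)"
  shows "fractionally_forces V E (indicator {e\<in>M. \<alpha> e = 1}) (indicator M)"
proof -
  let ?T = "{e\<in>M. \<alpha> e = 1}"
  have ME: "M \<subseteq> E" using M by (simp add: perfect_matching_def)
  have \<alpha>_le: "\<alpha> e \<le> indicator M e" if "e \<in> E" for e
    using forces that by (simp add: fractionally_forces_def dominated_def)
  \<comment> \<open>A step length that works for all edges of \<open>M\<close> outside \<open>?T\<close> at once; the extra \<open>1\<close> keeps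
    the combination convex, and the minimum defined when there are no such edges.\<close>
  define t where "t = Min (insert 1 ((\<lambda>e. 1 - \<alpha> e) ` (M - ?T)))"
  have fin: "finite (insert 1 ((\<lambda>e. 1 - \<alpha> e) ` (M - ?T)))"
    using finite_subset[OF ME simple_graph_finite_edges[OF G]] by simp
  have "\<forall>e\<in>M - ?T. \<alpha> e < 1" using \<alpha>_le ME by fastforce
  then have t0: "0 < t" unfolding t_def using fin by (subst Min_gr_iff) auto
  have t1: "t \<le> 1" unfolding t_def using fin by (intro Min_le) auto
  have t_le: "t \<le> 1 - \<alpha> e" if "e \<in> M - ?T" for e
    unfolding t_def using fin that by (intro Min_le) auto
  have "\<gamma> e = indicator M e"
    if \<gamma>: "fractional_perfect_matching V E \<gamma>" and one: "\<forall>e\<in>?T. 1 \<le> \<gamma> e" and e: "e \<in> E" for \<gamma> e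
  proof -
    let ?\<delta> = "\<lambda>e. (1 - t) * indicator M e + t * \<gamma> e"
    have "fractional_perfect_matching V E ?\<delta>"
      using fractional_perfect_matching_convex[OF fractional_perfect_matching_indicator[OF G M] \<gamma>]
        t0 t1 by simp
    moreover have "dominated E \<alpha> ?\<delta>"
      unfolding dominated_def
    proof
      fix e assume e: "e \<in> E"
      have pos: "0 \<le> t * \<gamma> e"
        using t0 fractional_perfect_matching_nonneg[OF \<gamma> e] by simp
      consider "e \<in> ?T" | "e \<in> M - ?T" | "e \<notin> M" by blast
      then show "\<alpha> e \<le> ?\<delta> e"
      proof cases
        case 1
        then have "t * 1 \<le> t * \<gamma> e" using one t0 by (intro mult_left_mono) auto
        then show ?thesis using 1 by simp
      next
        case 2
        then show ?thesis using t_le[OF 2] pos by simp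
      next
        case 3
        then show ?thesis using \<alpha>_le[OF e] pos by simp
      qed
    qed
    ultimately have "?\<delta> e = indicator M e"
      using forces e unfolding fractionally_forces_def by blast
    then have "t * (\<gamma> e - indicator M e) = 0" by (simp add: algebra_simps)
    then show ?thesis using t0 by simp
  qed
  then show ?thesis by (subst fractionally_forces_indicator_iff[OF G M]) auto
qed

lemma forcing_set_le_l1_norm:
  assumes G: "simple_graph V E" and M: "perfect_matching V E M"
    and forces: "fractionally_forces V E \<alpha> (indicator M)"
  obtains S where "forcing_set V E M S" "real (card S) \<le> l1_norm E \<alpha>"
proof -
  let ?T = "{e\<in>M. \<alpha> e = 1}"
  have "real (card ?T) = (\<Sum>e\<in>?T. \<bar>\<alpha> e\<bar>)" by simp
  also have "\<dots> \<le> l1_norm E \<alpha>"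
    unfolding l1_norm_def
    by (rule sum_mono2) (use M simple_graph_finite_edges[OF G] in \<open>auto simp: perfect_matching_def\<close>)
  finally have "real (card ?T) \<le> l1_norm E \<alpha>" .
  moreover have "forcing_set V E M ?T"
    by (rule fractionally_forces_imp_forcing[OF G M _ fractionally_forces_saturated[OF G M forces]])
      auto
  ultimately show ?thesis using that by blast
qed

section \<open>Alternating cycles in bipartite graphs\<close>

text \<open>A closed subset of minimal size works, since its image is again closed. This extracts a
  cycle from a self-map without iterating it.\<close>

lemma finite_self_map_bij_betw:
  assumes "finite D" "D \<noteq> {}" "f ` D \<subseteq> D"
  obtains C where "C \<subseteq> D" "C \<noteq> {}" "bij_betw f C C"
proof -
  let ?closed = "\<lambda>C. C \<subseteq> D \<and> C \<noteq> {} \<and> f ` C \<subseteq> C"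
  have "?closed D" using assms by simp
  then obtain C where closed: "?closed C" and min: "\<And>B. ?closed B \<Longrightarrow> card C \<le> card B"
    using ex_has_least_nat[of ?closed D card] by metis
  from closed have C: "C \<subseteq> D" "C \<noteq> {}" "f ` C \<subseteq> C" by simp_all
  have fin: "finite C" using finite_subset[OF C(1) assms(1)] .
  have "card C \<le> card (f ` C)" by (rule min) (use C in blast)
  then have "f ` C = C" using card_seteq[OF fin C(3)] by simp
  then have "bij_betw f C C" using fin by (simp add: bij_betw_def finite_surj_inj)
  then show ?thesis using that C by blast
qed

text \<open>Switching \<open>M\<close> along alternating cycles. The edge \<open>n e\<close> follows the matching edge \<open>e\<close> on the
  cycle: it leaves from the endpoint of \<open>e\<close> in \<open>X\<close> and arrives at the endpoint in \<open>Y\<close> of the next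
  matching edge \<open>f e\<close>. Since \<open>f\<close> permutes \<open>C\<close>, the new edges cover the same vertices on either
  side as the old ones, each exactly once.\<close>

lemma perfect_matching_switch:
  assumes M: "perfect_matching (X \<union> Y) E M"
    and C: "C \<subseteq> M" and f: "bij_betw f C C" and n: "n ` C \<subseteq> E"
    and X: "\<And>e. e \<in> C \<Longrightarrow> n e \<inter> X = e \<inter> X"
    and Y: "\<And>e. e \<in> C \<Longrightarrow> n e \<inter> Y = f e \<inter> Y"
  shows "perfect_matching (X \<union> Y) E ((M - C) \<union> n ` C)"
  unfolding perfect_matching_def
proof (intro conjI ballI)
  show "(M - C) \<union> n ` C \<subseteq> E" using M n by (auto simp: perfect_matching_def)
next
  fix v assume v: "v \<in> X \<union> Y"
  \<comment> \<open>The two sides differ only in the permutation of \<open>C\<close> that is involved.\<close>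
  obtain g where g: "bij_betw g C C" and ng: "\<And>e. e \<in> C \<Longrightarrow> v \<in> n e \<longleftrightarrow> v \<in> g e"
  proof (cases "v \<in> X")
    case True
    have "v \<in> n e \<longleftrightarrow> v \<in> id e" if "e \<in> C" for e using X[OF that] True by auto
    then show ?thesis using that[of id] by simp
  next
    case False
    then have "v \<in> n e \<longleftrightarrow> v \<in> f e" if "e \<in> C" for e using Y[OF that] v by auto
    then show ?thesis using that[of f] f by simp
  qed
  obtain m where m: "m \<in> M" "v \<in> m" using perfect_matching_edge[OF M v] .
  have uniq: "e = m" if "e \<in> M" "v \<in> e" for e
    using perfect_matching_unique[OF M v that m] .
  have gC: "g e \<in> C" if "e \<in> C" for e using bij_betwE[OF g] that by blast
  show "\<exists>!e. e \<in> (M - C) \<union> n ` C \<and> v \<in> e"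
  proof (cases "m \<in> C")
    case False
    have "v \<notin> n e" if "e \<in> C" for e
      using uniq[of "g e"] gC[OF that] ng[OF that] C False by auto
    then show ?thesis using m False uniq by blast
  next
    case True
    then obtain e where e: "e \<in> C" "g e = m" using bij_betw_imp_surj_on[OF g] by (metis imageE)
    have "e' = e" if "e' \<in> C" "v \<in> n e'" for e'
    proof -
      have "g e' = m" using uniq[of "g e'"] gC[OF that(1)] ng that C by auto
      then show ?thesis using bij_betw_imp_inj_on[OF g] e that(1) by (auto dest: inj_onD)
    qed
    moreover have "v \<in> n e" using ng[OF e(1)] e(2) m(2) by simp
    moreover have "v \<notin> e'" if "e' \<in> M - C" for e' using uniq[of e'] that True by auto
    ultimately show ?thesis using e(1) by blast
  qed
qed

text \<open>A matching edge \<open>e\<close> with \<open>\<gamma> e < 1\<close> leaves some weight at its endpoint in \<open>X\<close> for an edge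
  outside \<open>M\<close>; that edge takes weight away from the matching edge at its other end. So the
  deficient matching edges carry a successor map, and its cycles are the alternating cycles along
  which \<open>M\<close> is switched.\<close>

lemma bipartite_alternative_matching:
  assumes G: "simple_graph V E" and bip: "bipartite V E" and M: "perfect_matching V E M"
    and \<gamma>: "fractional_perfect_matching V E \<gamma>"
    and d: "d \<in> M" "\<gamma> d < 1"
  obtains M' where "perfect_matching V E M'" "M' \<noteq> M" "{e\<in>M. 1 \<le> \<gamma> e} \<subseteq> M'"
proof -
  obtain X Y where V: "X \<union> Y = V" and disj: "X \<inter> Y = {}"
    and XY: "\<And>e. e \<in> E \<Longrightarrow> \<exists>x\<in>X. \<exists>y\<in>Y. e = {x, y}"
    using bip unfolding bipartite_def by metis
  have ME: "M \<subseteq> E" using M by (simp add: perfect_matching_def)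
  define D where "D = {e\<in>M. \<gamma> e < 1}"
  have "\<exists>n m. n \<in> E \<and> n \<notin> M \<and> m \<in> D \<and> n \<inter> X = e \<inter> X \<and> n \<inter> Y = m \<inter> Y" if "e \<in> D" for e
  proof -
    have e: "e \<in> M" "e \<in> E" "\<gamma> e < 1" using that ME by (auto simp: D_def)
    obtain x y where x: "x \<in> X" "y \<in> Y" "e = {x, y}" using XY[OF e(2)] by blast
    have xV: "x \<in> V" "x \<in> e" using x V by auto
    obtain n where n: "n \<in> E" "x \<in> n" "n \<noteq> e" "0 < \<gamma> n"
      using fractional_perfect_matching_other_edge[OF G \<gamma> xV e(2,3)] .
    have nM: "n \<notin> M" using perfect_matching_unique[OF M xV(1) e(1) xV(2) _ n(2)] n(3) by auto
    obtain x' y' where n': "x' \<in> X" "y' \<in> Y" "n = {x', y'}" using XY[OF n(1)] by blast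
    have x': "x' = x" using n' n(2) x(1) disj by auto
    have y'V: "y' \<in> V" "y' \<in> n" using n' V by auto
    obtain m where m: "m \<in> M" "m \<in> E" "y' \<in> m" using perfect_matching_edge[OF M y'V(1)] .
    have "\<gamma> m + \<gamma> n \<le> 1"
      using fractional_perfect_matching_two_le_one[OF G \<gamma> y'V(1) m(3) y'V(2) m(2) n(1)] nM m(1)
      by auto
    then have "m \<in> D" using n(4) m(1) by (simp add: D_def)
    moreover have "n \<inter> X = e \<inter> X" using x n' x' disj by auto
    moreover have "n \<inter> Y = m \<inter> Y" using XY[OF m(2)] m(3) n' disj by auto
    ultimately show ?thesis using n(1) nM by blast
  qed
  then obtain n f where nf: "\<And>e. e \<in> D \<Longrightarrow>
      n e \<in> E \<and> n e \<notin> M \<and> f e \<in> D \<and> n e \<inter> X = e \<inter> X \<and> n e \<inter> Y = f e \<inter> Y"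
    by metis
  have "finite D"
    using finite_subset[OF _ simple_graph_finite_edges[OF G], of D] ME by (auto simp: D_def)
  moreover have "D \<noteq> {}" using d by (auto simp: D_def)
  moreover have "f ` D \<subseteq> D" using nf by auto
  ultimately obtain C where C: "C \<subseteq> D" "C \<noteq> {}" "bij_betw f C C"
    using finite_self_map_bij_betw by metis
  have "perfect_matching (X \<union> Y) E ((M - C) \<union> n ` C)"
    by (rule perfect_matching_switch[OF _ _ C(3)]) (use M V C(1) nf in \<open>auto simp: D_def\<close>)
  then have "perfect_matching V E ((M - C) \<union> n ` C)" by (simp add: V)
  moreover have "(M - C) \<union> n ` C \<noteq> M" using C nf by blast
  moreover have "{e\<in>M. 1 \<le> \<gamma> e} \<subseteq> (M - C) \<union> n ` C" using C(1) by (auto simp: D_def)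
  ultimately show ?thesis using that by blast
qed

lemma bipartite_forcing_imp_fractionally_forces:
  assumes G: "simple_graph V E" and bip: "bipartite V E" and M: "perfect_matching V E M"
    and S: "forcing_set V E M S"
  shows "fractionally_forces V E (indicator S) (indicator M)"
proof -
  have SM: "S \<subseteq> M" and only: "\<And>M'. perfect_matching V E M' \<Longrightarrow> S \<subseteq> M' \<Longrightarrow> M' = M"
    using S unfolding forcing_set_def by auto
  have "\<gamma> e = indicator M e"
    if \<gamma>: "fractional_perfect_matching V E \<gamma>" and one: "\<forall>e\<in>S. 1 \<le> \<gamma> e" and e: "e \<in> E" for \<gamma> e
  proof (rule fractional_perfect_matching_eq_indicator[OF G M \<gamma> _ e])
    fix d assume d: "d \<in> M"
    show "1 \<le> \<gamma> d"
    proof (rule ccontr)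
      assume "\<not> 1 \<le> \<gamma> d"
      then obtain M' where "perfect_matching V E M'" "M' \<noteq> M" "{e\<in>M. 1 \<le> \<gamma> e} \<subseteq> M'"
        using bipartite_alternative_matching[OF G bip M \<gamma> d] by auto
      then show False using only one SM by blast
    qed
  qed
  then show ?thesis using fractionally_forces_indicator_iff[OF G M SM] by blast
qed

section \<open>Forcing numbers\<close>

lemma finite_forcing_set_cards:
  assumes G: "simple_graph V E" and M: "perfect_matching V E M"
  shows "finite {card S | S. forcing_set V E M S}"
proof (rule finite_subset)
  have "finite M"
    using finite_subset[OF _ simple_graph_finite_edges[OF G]] M by (simp add: perfect_matching_def)
  then show "finite (card ` Pow M)" by simp
  show "{card S | S. forcing_set V E M S} \<subseteq> card ` Pow M"
    by (auto simp: forcing_set_def)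
qed

lemma forcing_number_le_fractional:
  assumes G: "simple_graph V E" and M: "perfect_matching V E M"
  shows "real (forcing_number V E M) \<le> fractional_forcing_number V E (indicator M)"
  unfolding fractional_forcing_number_def
proof (rule cInf_greatest)
  show "{l1_norm E \<alpha> | \<alpha>. fractionally_forces V E \<alpha> (indicator M)} \<noteq> {}"
    using fractionally_forces_indicator_self[OF G M] by blast
next
  fix r assume "r \<in> {l1_norm E \<alpha> | \<alpha>. fractionally_forces V E \<alpha> (indicator M)}"
  then obtain \<alpha> where \<alpha>: "fractionally_forces V E \<alpha> (indicator M)" and r: "r = l1_norm E \<alpha>"
    by blast
  obtain S where S: "forcing_set V E M S" "real (card S) \<le> l1_norm E \<alpha>"
    using forcing_set_le_l1_norm[OF G M \<alpha>] .
  have "forcing_number V E M \<le> card S"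
    unfolding forcing_number_def
    by (rule Min_le[OF finite_forcing_set_cards[OF G M]]) (use S in blast)
  then show "real (forcing_number V E M) \<le> r" using S(2) r by linarith
qed

lemma fractional_forcing_number_le_bipartite:
  assumes G: "simple_graph V E" and bip: "bipartite V E" and M: "perfect_matching V E M"
  shows "fractional_forcing_number V E (indicator M) \<le> real (forcing_number V E M)"
proof -
  have "forcing_set V E M M"
    using fractionally_forces_imp_forcing[OF G M subset_refl
        fractionally_forces_indicator_self[OF G M]] .
  then have "forcing_number V E M \<in> {card S | S. forcing_set V E M S}"
    unfolding forcing_number_def by (intro Min_in finite_forcing_set_cards[OF G M]) blast
  then obtain S where S: "forcing_set V E M S" "forcing_number V E M = card S" by auto
  have "S \<subseteq> E" using S(1) M by (auto simp: forcing_set_def perfect_matching_def)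
  then have "l1_norm E (indicator S) = real (card S)"
    using simple_graph_finite_edges[OF G]
    by (simp add: l1_norm_def indicator_def Int_absorb1 flip: Int_def)
  moreover have "fractional_forcing_number V E (indicator M) \<le> l1_norm E (indicator S)"
    unfolding fractional_forcing_number_def
  proof (rule cInf_lower)
    show "bdd_below {l1_norm E \<alpha> | \<alpha>. fractionally_forces V E \<alpha> (indicator M)}"
      by (rule bdd_belowI[of _ 0]) (auto simp: l1_norm_def sum_nonneg)
  qed (use bipartite_forcing_imp_fractionally_forces[OF G bip M S(1)] in blast)
  ultimately show ?thesis using S(2) by simp
qed

theorem lemma3p15:
  fixes V :: "'a set" and E :: "'a set set"
  assumes "simple_graph V E"
  shows "(\<forall>M. perfect_matching V E M \<longrightarrow>
            fractional_forcing_number V E (indicator M) \<ge> real (forcing_number V E M)) \<and>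
         (bipartite V E \<longrightarrow>
           (\<forall>M. perfect_matching V E M \<longrightarrow>
              fractional_forcing_number V E (indicator M) = real (forcing_number V E M)))"
  using forcing_number_le_fractional[OF assms] fractional_forcing_number_le_bipartite[OF assms]
  by (auto intro: antisym)

end
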